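(* Let $S$ be a numerical semigroup with Frobenius number $f$ and genus $g(S)$, and let $d \geq 2$ be an integer. Then $$\min\left\{ g(\overline{S}) \ \middle|\ \overline{S} \text{ is a numerical semigroup with } S = \frac{\overline{S}}{d} \right\} = g(S) + \left\lceil \frac{(d-1)f}{2} \right\rceil .$$
   Context: $\mathbb{N}$ denotes the set of nonnegative integers. A numerical semigroup is a submonoid $S$ of $(\mathbb{N},+)$ (so $0\in S$) such that $\mathbb{N}\setminus S$ is finite. The genus $g(S)$ is the cardinality of $\mathbb{N}\setminus S$, and the Frobenius number $f(S)$ is the largest integer not belonging to $S$. For a numerical semigroup $T$ and a positive integer $d$, the quotient is $\frac{T}{d} = \{ s \in \mathbb{N} \mid ds \in T\}$.
   Formalization: The case S = ℕ with d ≥ 3 is excluded, since there f = −1 makes the right-hand side negative while the minimum genus is 0, so the formula fails; S = ℕ with d = 2 is kept. *)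

theory Defs
  imports Complex_Main
begin

definition numerical_semigroup :: "nat set \<Rightarrow> bool" where
  "numerical_semigroup S \<longleftrightarrow>
     0 \<in> S \<and> (\<forall>a\<in>S. \<forall>b\<in>S. a + b \<in> S) \<and> finite (UNIV - S)"

definition genus :: "nat set \<Rightarrow> nat" where
  "genus S = card (UNIV - S)"

(* The largest element is taken over the integers, so frobenius UNIV = -1. *)
definition frobenius :: "nat set \<Rightarrow> int" where
  "frobenius S = (GREATEST x. x \<notin> int ` S)"

definition quot :: "nat set \<Rightarrow> nat \<Rightarrow> nat set" where
  "quot T d = {s. d * s \<in> T}"

definition quotient_genera :: "nat set \<Rightarrow> nat \<Rightarrow> nat set" where
  "quotient_genera S d = {genus T | T. numerical_semigroup T \<and> S = quot T d}"

end

theory Submission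
  imports Defs
begin

text \<open>
  Split the gaps of a semigroup \<open>T\<close> with \<open>quot T d = S\<close> according to divisibility by \<open>d\<close>. The gaps
  divisible by \<open>d\<close> are the numbers \<open>d * s\<close> with \<open>s\<close> a gap of \<open>S\<close>, so they contribute \<open>genus S\<close>
  whatever \<open>T\<close> is (\<open>genus_eq_genus_quot_plus_nonmultiples\<close>), and only the other gaps have to be
  minimised.

  Let \<open>f\<close> be the Frobenius number of \<open>S\<close> and suppose \<open>f > 0\<close>. Since \<open>f\<close> is a gap of \<open>S\<close>, the number
  \<open>d * f\<close> is a gap of \<open>T\<close>, so \<open>x\<close> and \<open>d * f - x\<close> never both lie in \<open>T\<close>. The reflection
  \<open>x \<mapsto> d * f - x\<close> permutes the \<open>(d - 1) * f\<close> numbers below \<open>d * f\<close> that \<open>d\<close> does not divide, hence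
  at least half of these are gaps (\<open>nonmultiple_gaps_lower_bound\<close>).

  Equality is attained by taking all of \<open>d * S\<close> together with every nonmultiple of \<open>d\<close> above
  \<open>d * f / 2\<close>. This is closed under addition: two of the added numbers have a sum exceeding
  \<open>d * f\<close>, and if that sum is a multiple of \<open>d\<close> its quotient exceeds \<open>f\<close> and so lies in \<open>S\<close>. Its
  gaps outside the multiples of \<open>d\<close> are the lower half of the reflected set, the midpoint
  \<open>d * f / 2\<close> included when it is a nonmultiple of \<open>d\<close>; this accounts for the ceiling.

  The remaining case, \<open>S = UNIV\<close> with Frobenius number \<open>-1\<close> and \<open>d = 2\<close>, has the witness
  \<open>T = UNIV\<close>.
\<close>

lemma frobenius_UNIV: "frobenius UNIV = -1"
  unfolding frobenius_def
proof (rule Greatest_equality)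
  show "(-1::int) \<notin> range int" by auto
next
  fix y :: int assume "y \<notin> range int"
  then show "y \<le> -1" by (metis nat_0_le rangeI linorder_not_le zle_diff1_eq diff_0)
qed

lemma frobenius_nat:
  assumes "finite (UNIV - S)" "S \<noteq> UNIV"
  obtains f :: nat where "frobenius S = int f" "f \<notin> S" "\<And>n. n > f \<Longrightarrow> n \<in> S"
proof -
  let ?f = "Max (UNIV - S)"
  have ne: "UNIV - S \<noteq> {}" using assms(2) by auto
  have f: "?f \<in> UNIV - S" using Max_in[OF assms(1) ne] .
  have above: "n \<in> S" if "n > ?f" for n
    using Max_ge[OF assms(1), of n] that by auto
  have "frobenius S = int ?f"
    unfolding frobenius_def
  proof (rule Greatest_equality)
    show "int ?f \<notin> int ` S" using f by auto
  next
    fix y :: int assume y: "y \<notin> int ` S"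
    show "y \<le> int ?f"
    proof (rule ccontr)
      assume "\<not> y \<le> int ?f"
      then have "nat y > ?f" "y = int (nat y)" by auto
      with above y show False by blast
    qed
  qed
  with f above show ?thesis using that by auto
qed

definition nonmultiples_below :: "nat \<Rightarrow> nat \<Rightarrow> nat set" where
  "nonmultiples_below d n = {x. x < d * n \<and> \<not> d dvd x}"

lemma finite_nonmultiples_below: "finite (nonmultiples_below d n)"
  by (simp add: nonmultiples_below_def)

lemma card_nonmultiples_below:
  assumes "d > 0"
  shows "card (nonmultiples_below d n) = (d - 1) * n"
proof -
  have "nonmultiples_below d n = {..<d * n} - (*) d ` {..<n}"
    using assms by (auto simp: nonmultiples_below_def)
  moreover have "card ({..<d * n} - (*) d ` {..<n}) = d * n - n"
    using assms by (subst card_Diff_subset) (auto simp: card_image inj_on_def)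
  ultimately show ?thesis by (simp add: diff_mult_distrib)
qed

lemma reflect_nonmultiples_below:
  assumes "x \<in> nonmultiples_below d n"
  shows "d * n - x \<in> nonmultiples_below d n"
proof -
  have x: "x < d * n" "\<not> d dvd x" using assms by (auto simp: nonmultiples_below_def)
  then have "x > 0" by (metis dvd_0_right gr0I)
  have "\<not> d dvd d * n - x"
  proof
    assume "d dvd d * n - x"
    then have "d dvd d * n - (d * n - x)" by (rule dvd_diff_nat[OF dvd_triv_left])
    moreover have "d * n - (d * n - x) = x" using x by simp
    ultimately show False using x by metis
  qed
  with x \<open>x > 0\<close> show ?thesis by (auto simp: nonmultiples_below_def)
qed

lemma inj_on_reflect_nonmultiples_below:
  "inj_on (\<lambda>x. d * n - x) (nonmultiples_below d n)"
  by (auto simp: inj_on_def nonmultiples_below_def)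

text \<open>
  The reflection exchanges the numbers up to \<open>d * n / 2\<close> with those from \<open>d * n / 2\<close> on. The two
  halves share at most the midpoint, which is why the lower one is exactly half, rounded up.
\<close>

lemma card_lower_half_nonmultiples_below:
  assumes "d > 0"
  shows "card {x \<in> nonmultiples_below d n. 2 * x \<le> d * n} = ((d - 1) * n + 1) div 2"
proof -
  let ?N = "nonmultiples_below d n"
  let ?L = "{x \<in> ?N. 2 * x \<le> d * n}" and ?U = "{x \<in> ?N. 2 * x \<ge> d * n}"
  note fin = finite_nonmultiples_below[of d n]
  have "(\<lambda>x. d * n - x) ` ?L = ?U"
  proof (intro equalityI subsetI)
    fix y assume "y \<in> (\<lambda>x. d * n - x) ` ?L"
    then show "y \<in> ?U" using reflect_nonmultiples_below[of _ d n] by auto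
  next
    fix y assume y: "y \<in> ?U"
    then have "y < d * n" by (auto simp: nonmultiples_below_def)
    then have "d * n - y \<in> ?L" "y = d * n - (d * n - y)"
      using y reflect_nonmultiples_below[of y d n] by auto
    then show "y \<in> (\<lambda>x. d * n - x) ` ?L" by blast
  qed
  then have "card ?U = card ?L"
    using card_image[OF inj_on_subset[OF inj_on_reflect_nonmultiples_below[of d n], of ?L]]
    by auto
  moreover have "card ?L + card ?U = card (?L \<union> ?U) + card (?L \<inter> ?U)"
    using fin by (intro card_Un_Int) auto
  moreover have "?L \<union> ?U = ?N" by auto
  moreover have "card (?L \<inter> ?U) \<le> card {d * n div 2}"
    by (intro card_mono) auto
  ultimately have "2 * card ?L = (d - 1) * n + card (?L \<inter> ?U)" "card (?L \<inter> ?U) \<le> 1"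
    using card_nonmultiples_below[OF assms, of n] by auto
  then show ?thesis by linarith
qed

lemma genus_eq_genus_quot_plus_nonmultiples:
  assumes "finite (UNIV - T)" "d > 0"
  shows "genus T = genus (quot T d) + card {x. x \<notin> T \<and> \<not> d dvd x}"
proof -
  have split: "UNIV - T = (*) d ` (UNIV - quot T d) \<union> {x. x \<notin> T \<and> \<not> d dvd x}"
    by (auto simp: quot_def elim!: dvdE)
  have "card (UNIV - T) = card ((*) d ` (UNIV - quot T d)) + card {x. x \<notin> T \<and> \<not> d dvd x}"
    using assms(1) by (subst split, intro card_Un_disjoint) (auto simp: split)
  moreover have "card ((*) d ` (UNIV - quot T d)) = card (UNIV - quot T d)"
    using assms(2) by (intro card_image) (auto simp: inj_on_def)
  ultimately show ?thesis by (simp add: genus_def)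
qed

text \<open>
  If \<open>x\<close> and \<open>d * f - x\<close> were both in \<open>T\<close>, then so would be their sum \<open>d * f\<close>, making \<open>f\<close> an
  element of the quotient. The reflection thus maps the nonmultiples below \<open>d * f\<close> that belong to \<open>T\<close> injectively to ones that do not.
\<close>

lemma nonmultiple_gaps_lower_bound:
  assumes T: "numerical_semigroup T" and f: "f \<notin> quot T d" and d: "d > 0"
  shows "((d - 1) * f + 1) div 2 \<le> card {x. x \<notin> T \<and> \<not> d dvd x}"
proof -
  let ?N = "nonmultiples_below d f"
  note fin = finite_nonmultiples_below[of d f]
  have add: "a + b \<in> T" if "a \<in> T" "b \<in> T" for a b
    using T that by (auto simp: numerical_semigroup_def)
  have "card (?N \<inter> T) \<le> card (?N - T)"
  proof (rule card_inj_on_le)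
    show "inj_on (\<lambda>x. d * f - x) (?N \<inter> T)"
      using inj_on_reflect_nonmultiples_below by (rule inj_on_subset) auto
    show "(\<lambda>x. d * f - x) ` (?N \<inter> T) \<subseteq> ?N - T"
    proof
      fix y assume "y \<in> (\<lambda>x. d * f - x) ` (?N \<inter> T)"
      then obtain x where x: "x \<in> ?N" "x \<in> T" "y = d * f - x" by auto
      then have "x + y = d * f" by (auto simp: nonmultiples_below_def)
      then have "y \<notin> T" using add[OF x(2), of y] f by (auto simp: quot_def)
      then show "y \<in> ?N - T" using reflect_nonmultiples_below[OF x(1)] x(3) by auto
    qed
    show "finite (?N - T)" using fin by auto
  qed
  moreover have "card ?N = card (?N \<inter> T) + card (?N - T)"
    using fin by (metis card_Int_Diff)
  moreover have "card (?N - T) \<le> card {x. x \<notin> T \<and> \<not> d dvd x}"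
  proof (rule card_mono)
    have "finite (UNIV - T)" using T by (simp add: numerical_semigroup_def)
    then show "finite {x. x \<notin> T \<and> \<not> d dvd x}" by (rule finite_subset[rotated]) auto
  qed (auto simp: nonmultiples_below_def)
  ultimately show ?thesis using card_nonmultiples_below[OF d, of f] by linarith
qed

definition extremal_preimage :: "nat set \<Rightarrow> nat \<Rightarrow> nat \<Rightarrow> nat set" where
  "extremal_preimage S d f = (*) d ` S \<union> {x. \<not> d dvd x \<and> d * f < 2 * x}"

lemma quot_extremal_preimage:
  assumes "d > 0"
  shows "quot (extremal_preimage S d f) d = S"
  using assms by (auto simp: extremal_preimage_def quot_def)

text \<open>
  Closure under addition is in doubt only for two nonmultiples of \<open>d\<close>: both exceed \<open>d * f / 2\<close>, so
  if their sum is \<open>d * k\<close> then \<open>k > f\<close> and hence \<open>k \<in> S\<close>. Adding a nonmultiple to a multiple only moves the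
  nonmultiple upwards.
\<close>

lemma numerical_semigroup_extremal_preimage:
  assumes S: "numerical_semigroup S" and d: "d > 0" and above: "\<And>n. n > f \<Longrightarrow> n \<in> S"
  shows "numerical_semigroup (extremal_preimage S d f)"
  unfolding numerical_semigroup_def
proof (intro conjI ballI)
  let ?T = "extremal_preimage S d f"
  have S0: "0 \<in> S" and Sadd: "\<And>a b. a \<in> S \<Longrightarrow> b \<in> S \<Longrightarrow> a + b \<in> S"
    using S by (auto simp: numerical_semigroup_def)
  show "0 \<in> ?T" using S0 by (force simp: extremal_preimage_def)
  show "a + b \<in> ?T" if ab: "a \<in> ?T" "b \<in> ?T" for a b
  proof -
    consider (mm) s t where "a = d * s" "b = d * t" "s \<in> S" "t \<in> S"
      | (mn) s where "a = d * s" "\<not> d dvd b" "d * f < 2 * b"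
      | (nm) t where "b = d * t" "\<not> d dvd a" "d * f < 2 * a"
      | (nn) "d * f < 2 * a" "d * f < 2 * b"
      using ab unfolding extremal_preimage_def by blast
    then show ?thesis
    proof cases
      case mm
      then have "a + b = d * (s + t)" by (simp add: distrib_left)
      with mm show ?thesis using Sadd by (auto simp: extremal_preimage_def)
    next
      case mn
      then show ?thesis by (auto simp: extremal_preimage_def dvd_add_right_iff)
    next
      case nm
      then show ?thesis by (auto simp: extremal_preimage_def dvd_add_left_iff)
    next
      case nn
      then have gt: "d * f < a + b" by linarith
      show ?thesis
      proof (cases "d dvd a + b")
        case True
        then obtain k where k: "a + b = d * k" by (elim dvdE)
        with gt have "f < k" by simp
        with k above show ?thesis by (auto simp: extremal_preimage_def)
      next
        case False
        with gt show ?thesis by (auto simp: extremal_preimage_def)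
      qed
    qed
  qed
  have "UNIV - ?T \<subseteq> {..d * f}"
  proof
    fix x assume x: "x \<in> UNIV - ?T"
    show "x \<in> {..d * f}"
    proof (rule ccontr)
      assume "x \<notin> {..d * f}"
      then have gt: "d * f < x" by simp
      with x have "d dvd x" by (auto simp: extremal_preimage_def)
      then obtain k where k: "x = d * k" by (elim dvdE)
      with gt have "f < k" by simp
      with k above x show False by (auto simp: extremal_preimage_def)
    qed
  qed
  then show "finite (UNIV - ?T)" by (rule finite_subset) simp
qed

lemma card_nonmultiple_gaps_extremal_preimage:
  assumes "d > 0"
  shows "card {x. x \<notin> extremal_preimage S d f \<and> \<not> d dvd x} = ((d - 1) * f + 1) div 2"
proof -
  have "x < d * f" if "\<not> d dvd x" "2 * x \<le> d * f" for x
    using that by (cases "x = 0") auto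
  then have "{x. x \<notin> extremal_preimage S d f \<and> \<not> d dvd x}
      = {x \<in> nonmultiples_below d f. 2 * x \<le> d * f}"
    by (auto simp: extremal_preimage_def nonmultiples_below_def)
  then show ?thesis using card_lower_half_nonmultiples_below[OF assms] by simp
qed

lemma Inf_quotient_genera:
  assumes S: "numerical_semigroup S" and d: "d > 0"
    and f: "f \<notin> S" and above: "\<And>n. n > f \<Longrightarrow> n \<in> S"
  shows "Inf (quotient_genera S d) \<in> quotient_genera S d"
    and "Inf (quotient_genera S d) = genus S + ((d - 1) * f + 1) div 2"
proof -
  let ?m = "genus S + ((d - 1) * f + 1) div 2"
  let ?T = "extremal_preimage S d f"
  have T: "numerical_semigroup ?T"
    using S d above by (rule numerical_semigroup_extremal_preimage)
  then have "genus ?T = ?m"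
    using genus_eq_genus_quot_plus_nonmultiples[of ?T d] d
    by (simp add: numerical_semigroup_def quot_extremal_preimage
        card_nonmultiple_gaps_extremal_preimage)
  with T have mem: "?m \<in> quotient_genera S d"
    using quot_extremal_preimage[OF d, of S f] unfolding quotient_genera_def
    by (intro CollectI exI[of _ ?T]) simp
  have lower: "?m \<le> n" if n: "n \<in> quotient_genera S d" for n
  proof -
    obtain U where U: "n = genus U" "numerical_semigroup U" "S = quot U d"
      using n unfolding quotient_genera_def by blast
    then show ?thesis
      using genus_eq_genus_quot_plus_nonmultiples[of U d] nonmultiple_gaps_lower_bound[of U f d] f d
      by (simp add: numerical_semigroup_def)
  qed
  show eq: "Inf (quotient_genera S d) = ?m" using mem lower by (rule cInf_eq_minimum)
  show "Inf (quotient_genera S d) \<in> quotient_genera S d" using mem eq by simp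
qed

theorem theorem2p1:
  fixes S :: "nat set" and d :: nat
  assumes "numerical_semigroup S"
    and "d \<ge> 2"
    and "S \<noteq> UNIV \<or> d = 2"
  shows "Inf (quotient_genera S d) \<in> quotient_genera S d
       \<and> int (Inf (quotient_genera S d))
           = int (genus S) + \<lceil>(real d - 1) * real_of_int (frobenius S) / 2\<rceil>"
proof (cases "S = UNIV")
  case True
  with assms have d: "d = 2" by simp
  have "numerical_semigroup UNIV" "quot UNIV d = UNIV" "genus UNIV = 0"
    by (auto simp: numerical_semigroup_def quot_def genus_def)
  then have mem: "0 \<in> quotient_genera S d"
    unfolding quotient_genera_def True by (metis (mono_tags, lifting) mem_Collect_eq)
  then have "Inf (quotient_genera S d) = 0" by (rule cInf_eq_minimum) simp
  moreover have "\<lceil>(real d - 1) * real_of_int (frobenius S) / 2\<rceil> = 0"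
    by (simp add: True d frobenius_UNIV ceiling_eq_iff)
  ultimately show ?thesis using mem True by (simp add: genus_def)
next
  case False
  have "finite (UNIV - S)" using assms(1) by (simp add: numerical_semigroup_def)
  from frobenius_nat[OF this False] obtain f where
    frob: "frobenius S = int f" and f: "f \<notin> S" and above: "\<And>n. n > f \<Longrightarrow> n \<in> S" by blast
  have "(real d - 1) * real_of_int (frobenius S) = real ((d - 1) * f)"
    using assms(2) frob by (simp add: of_nat_diff)
  moreover have "\<lceil>real k / 2\<rceil> = int ((k + 1) div 2)" for k :: nat
    by (rule ceiling_unique) linarith+
  ultimately have "\<lceil>(real d - 1) * real_of_int (frobenius S) / 2\<rceil> = int (((d - 1) * f + 1) div 2)"
    by presburger
  then show ?thesis using Inf_quotient_genera[OF assms(1) _ f above, of d] assms(2) by simp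
qed

end
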